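(* Not every binary self-dual convolutional code with free distance $d_{free}>2$ can be constructed with the generalized building-up construction, up to permutation of columns. That is, there exists a binary self-dual convolutional code $\mathcal{C}$ with $d_{free}(\mathcal{C})>2$ such that no code obtained from $\mathcal{C}$ by permuting coordinates is generated by a matrix produced by the generalized building-up construction.
   Context: A binary $(n,k)$ convolutional code is an $\mathbb{F}_2[z]$-submodule $\mathcal{C}\subset\mathbb{F}_2[z]^n$ of rank $k$. A generator matrix of $\mathcal{C}$ is a matrix in $\mathbb{F}_2[z]^{k\times n}$ whose rows form a basis of $\mathcal{C}$. The dual is $\mathcal{C}^\perp=\{f(z)\in\mathbb{F}_2[z]^n : f(z)c(z)^\top=0\ \forall c(z)\in\mathcal{C}\}$, and $\mathcal{C}$ is self-dual if $\mathcal{C}=\mathcal{C}^\perp$ (then $n=2k$). The weight of $c(z)=\sum_i c_iz^i\in\mathbb{F}_2[z]^n$, $c_i\in\mathbb{F}_2^n$, is $wt(c(z))=\sum_i wt(c_i)$ with $wt(c_i)$ the Hamming weight, and $d_{free}(\mathcal{C})=\min\{wt(c(z)) : c(z)\in\mathcal{C}\setminus\{0\}\}$. Generalized building-up construction (binary case): given a generator matrix $G(z)\in\mathbb{F}_2[z]^{k\times 2k}$, with rows $g_1(z),\dots,g_k(z)$, of a binary self-dual $(2k,k)$ convolutional code, and $f(z)\in\mathbb{F}_2[z]^{2k}$ with $f(z)f(z)^\top=1$, put $y_i(z)=f(z)g_i(z)^\top$ and form $$\begin{pmatrix}1&0&f(z)\\ y_1(z)&y_1(z)&g_1(z)\\ \vdots&\vdots&\vdots\\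 y_k(z)&y_k(z)&g_k(z)\end{pmatrix}\in\mathbb{F}_2[z]^{(k+1)\times(2k+2)},$$ which generates a self-dual $(2k+2,k+1)$ convolutional code. *)

theory Defs
  imports
    "HOL-Library.Z2"
    "HOL-Combinatorics.Permutations"
    "Jordan_Normal_Form.VS_Connect"
begin

(* The field with two elements is the type bit, so F_2[z] is bit poly and F_2[z]^n is
   carrier_vec n :: bit poly vec set. *)

abbreviation free_mod :: "nat \<Rightarrow> (bit poly, bit poly vec) module" where
  "free_mod n \<equiv> module_vec TYPE(bit poly) n"

(* Linear independence and span are taken of the set of rows, so distinctness of the rows is
   needed to express that the family of rows is a basis. *)
definition generator_matrix :: "nat \<Rightarrow> nat \<Rightarrow> bit poly vec set \<Rightarrow> bit poly mat \<Rightarrow> bool" where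
  "generator_matrix n k C G \<longleftrightarrow>
     G \<in> carrier_mat k n \<and>
     distinct (rows G) \<and>
     \<not> LinearCombinations.module.lin_dep class_ring (free_mod n) (set (rows G)) \<and>
     LinearCombinations.module.span class_ring (free_mod n) (set (rows G)) = C"

(* F_2[z] is a principal ideal domain, hence every submodule of F_2[z]^n is free and
   its rank is the size of a basis. *)
definition conv_code :: "nat \<Rightarrow> nat \<Rightarrow> bit poly vec set \<Rightarrow> bool" where
  "conv_code n k C \<longleftrightarrow>
     LinearCombinations.submodule class_ring C (free_mod n) \<and> (\<exists>G. generator_matrix n k C G)"

definition dual_code :: "nat \<Rightarrow> bit poly vec set \<Rightarrow> bit poly vec set" where
  "dual_code n C = {f \<in> carrier_vec n. \<forall>c\<in>C. f \<bullet> c = 0}"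

definition self_dual :: "nat \<Rightarrow> bit poly vec set \<Rightarrow> bool" where
  "self_dual n C \<longleftrightarrow> C = dual_code n C"

definition hamming_weight :: "bit vec \<Rightarrow> nat" where
  "hamming_weight v = card {j. j < dim_vec v \<and> v $ j \<noteq> 0}"

definition coeff_vec :: "bit poly vec \<Rightarrow> nat \<Rightarrow> bit vec" where
  "coeff_vec c i = map_vec (\<lambda>p. coeff p i) c"

(* The index set of the sum is finite: it is bounded by the degrees of the entries of c. *)
definition wt :: "bit poly vec \<Rightarrow> nat" where
  "wt c = (\<Sum>i | coeff_vec c i \<noteq> 0\<^sub>v (dim_vec c). hamming_weight (coeff_vec c i))"

(* The infimum of natural numbers is the minimum, provided that C contains a nonzero vector. *)
definition d_free :: "nat \<Rightarrow> bit poly vec set \<Rightarrow> nat" where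
  "d_free n C = Inf (wt ` (C - {0\<^sub>v n}))"

definition permute_code ::
    "nat \<Rightarrow> (nat \<Rightarrow> nat) \<Rightarrow> bit poly vec set \<Rightarrow> bit poly vec set" where
  "permute_code n \<pi> C = (\<lambda>c. vec n (\<lambda>i. c $ \<pi> i)) ` C"

definition building_up :: "bit poly vec \<Rightarrow> bit poly mat \<Rightarrow> bit poly mat" where
  "building_up f G = mat_of_rows (dim_col G + 2)
     (vCons 1 (vCons 0 f) # map (\<lambda>g. vCons (f \<bullet> g) (vCons (f \<bullet> g) g)) (rows G))"

definition building_up_matrix :: "bit poly mat \<Rightarrow> bool" where
  "building_up_matrix M \<longleftrightarrow>
     (\<exists>k C G f. conv_code (2 * k) k C \<and> self_dual (2 * k) C \<and> generator_matrix (2 * k) k C G \<and>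
        f \<in> carrier_vec (2 * k) \<and> f \<bullet> f = 1 \<and> M = building_up f G)"

lemma finite_coeff_vec_support:
  "finite {i. coeff_vec c i \<noteq> 0\<^sub>v (dim_vec c)}"
proof (rule finite_subset)
  show "{i. coeff_vec c i \<noteq> 0\<^sub>v (dim_vec c)} \<subseteq> (\<Union>j\<in>{..<dim_vec c}. {..degree (c $ j)})"
  proof
    fix i assume "i \<in> {i. coeff_vec c i \<noteq> 0\<^sub>v (dim_vec c)}"
    then have ne: "coeff_vec c i \<noteq> 0\<^sub>v (dim_vec c)" by simp
    have "\<exists>j<dim_vec c. coeff (c $ j) i \<noteq> 0"
    proof (rule ccontr)
      assume "\<not> ?thesis"
      then have "coeff_vec c i = 0\<^sub>v (dim_vec c)"
        by (intro eq_vecI) (simp_all add: coeff_vec_def)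
      with ne show False by contradiction
    qed
    then obtain j where j: "j < dim_vec c" and "coeff (c $ j) i \<noteq> 0" by blast
    then have "i \<le> degree (c $ j)" by (intro le_degree)
    with j show "i \<in> (\<Union>j\<in>{..<dim_vec c}. {..degree (c $ j)})" by blast
  qed
  show "finite (\<Union>j\<in>{..<dim_vec c}. {..degree (c $ j)})"
    by (rule finite_UN_I) simp_all
qed

end

theory Submission
  imports Defs
begin

text \<open>
  Every matrix produced by the building-up construction has a row with an entry \<open>1\<close> and an entry
  \<open>0\<close>. So it suffices to find a self-dual code in which the difference of two entries of a codeword
  is never \<open>1\<close>. Take the code generated by \<open>(1, 1, 1, 1)\<close> and \<open>w = (z, z^2 + 1, z^2 + z + 1, 0)\<close>:
  the entries of a codeword are \<open>a + b w_i\<close>, the differences of the \<open>w_i\<close> are the polynomials \<open>z\<close>,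
  \<open>z^2 + 1\<close>, \<open>z^2 + z + 1\<close>, and none of these is a unit. Since they are also nonzero, a nonzero
  codeword has at most one zero entry, hence weight at least \<open>3\<close>.
\<close>

section \<open>Characteristic 2, modules with two generators, and weights\<close>

lemma bit_poly_2: "(2 :: bit poly) = 0"
  by (rule poly_eqI) (simp add: numeral_poly)

text \<open>Lets an identity modulo 2 be proved as one valid in every commutative ring: an explicit
  even term \<open>2 * r\<close> carries the discrepancy.\<close>

lemma bit_poly_eqI: "p = q + 2 * r \<Longrightarrow> p = (q :: bit poly)"
  by (simp add: bit_poly_2)

lemma all_less_4: "(\<forall>i<4. P i) \<longleftrightarrow> P 0 \<and> P 1 \<and> P 2 \<and> P (3::nat)"
  by (auto simp: numeral_eq_Suc less_Suc_eq)

lemma (in vec_module) lincomb_pair: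
  assumes "u \<in> carrier_vec n" "v \<in> carrier_vec n" "u \<noteq> v"
  shows "lincomb a {u, v} = a u \<cdot>\<^sub>v u + a v \<cdot>\<^sub>v v"
  using assms by (simp add: lincomb_def)

lemma (in vec_module) span_pair:
  assumes "u \<in> carrier_vec n" "v \<in> carrier_vec n" "u \<noteq> v"
  shows "span {u, v} = {a \<cdot>\<^sub>v u + b \<cdot>\<^sub>v v | a b. True}"
proof -
  have "span {u, v} = {lincomb a {u, v} | a. True}"
    using finite_span[of "{u, v}"] assms by simp
  also have "\<dots> = {a u \<cdot>\<^sub>v u + a v \<cdot>\<^sub>v v | a. True}"
    using assms by (simp add: lincomb_pair)
  also have "\<dots> = {a \<cdot>\<^sub>v u + b \<cdot>\<^sub>v v | a b. True}" (is "?L = ?R")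
  proof
    show "?R \<subseteq> ?L"
    proof
      fix x assume "x \<in> ?R"
      then obtain a b where "x = a \<cdot>\<^sub>v u + b \<cdot>\<^sub>v v" by blast
      with assms(3) show "x \<in> ?L"
        \<comment> \<open>As \<open>u\<close> and \<open>v\<close> differ, this coefficient function
          takes the values \<open>a\<close> at \<open>u\<close> and \<open>b\<close> at
          \<open>v\<close>.\<close>
        by (auto intro!: exI[of _ "(\<lambda>_. b)(u := a)"])
    qed
  qed blast
  finally show ?thesis .
qed

lemma (in vec_module) lin_indpt_pair:
  assumes "u \<in> carrier_vec n" "v \<in> carrier_vec n" "u \<noteq> v"
    and "\<And>a b. a \<cdot>\<^sub>v u + b \<cdot>\<^sub>v v = 0\<^sub>v n \<Longrightarrow> a = 0 \<and> b = 0"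
  shows "lin_indpt {u, v}"
  by (rule finite_lin_indpt2) (use assms in \<open>auto simp: lincomb_pair\<close>)

text \<open>Each nonzero polynomial entry has a nonzero coefficient, so its position is counted in
  at least one coefficient vector; the union bound does the rest.\<close>

lemma card_support_le_wt: "card {j. j < dim_vec c \<and> c $ j \<noteq> 0} \<le> wt c"
proof -
  let ?I = "{i. coeff_vec c i \<noteq> 0\<^sub>v (dim_vec c)}"
  let ?S = "\<lambda>i. {j. j < dim_vec c \<and> coeff (c $ j) i \<noteq> 0}"
  have fin: "finite ?I" by (rule finite_coeff_vec_support)
  have "{j. j < dim_vec c \<and> c $ j \<noteq> 0} \<subseteq> (\<Union>i\<in>?I. ?S i)"
  proof
    fix j assume "j \<in> {j. j < dim_vec c \<and> c $ j \<noteq> 0}"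
    then have j: "j < dim_vec c" and "c $ j \<noteq> 0" by auto
    then obtain i where i: "coeff (c $ j) i \<noteq> 0" by (auto simp: poly_eq_iff)
    have "coeff_vec c i $ j \<noteq> 0" using i j by (simp add: coeff_vec_def)
    then have "i \<in> ?I" using j by auto
    with i j show "j \<in> (\<Union>i\<in>?I. ?S i)" by blast
  qed
  then have "card {j. j < dim_vec c \<and> c $ j \<noteq> 0} \<le> card (\<Union>i\<in>?I. ?S i)"
    by (rule card_mono[rotated]) (use fin in auto)
  also have "\<dots> \<le> (\<Sum>i\<in>?I. card (?S i))" using fin by (rule card_UN_le)
  also have "\<dots> = (\<Sum>i\<in>?I. hamming_weight (coeff_vec c i))"
    unfolding hamming_weight_def coeff_vec_def
    by (intro sum.cong refl arg_cong[where f = card]) auto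
  finally show ?thesis unfolding wt_def .
qed

lemma building_up_matrix_entries:
  assumes "building_up_matrix M"
  shows "dim_row M > 0" "row M 0 $ 0 = 1" "row M 0 $ 1 = 0"
  using assms by (auto simp: building_up_matrix_def building_up_def generator_matrix_def mat_of_rows_def)

lemma row_in_code:
  assumes "generator_matrix n k C M" "i < dim_row M"
  shows "row M i \<in> C"
proof -
  interpret vec_module "TYPE(bit poly)" n .
  have "set (rows M) \<subseteq> carrier_vec n"
    using assms rows_carrier[of M] by (metis carrier_matD(2) generator_matrix_def)
  from in_own_span[OF this] have "set (rows M) \<subseteq> C"
    using assms by (simp add: generator_matrix_def)
  then show ?thesis using assms(2) by (auto simp: rows_def)
qed

section \<open>The example code of length 4 and the differences of its entries\<close>

definition u_vec :: "bit poly vec" where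
  "u_vec = vec 4 (\<lambda>_. 1)"

text \<open>The four entries form an additive group, so their differences are again entries. Their
  sum is zero, which in characteristic 2 makes \<open>w_vec\<close> orthogonal both to
  \<open>u_vec\<close> and to itself. The entries \<open>z\<close> and \<open>z^2 + 1\<close> are
  coprime, which self-duality will need.\<close>

definition w_vec :: "bit poly vec" where
  "w_vec = vec 4 (\<lambda>i. [[:0, 1:], [:1, 0, 1:], [:1, 1, 1:], 0] ! i)"

definition C4 :: "bit poly vec set" where
  "C4 = {a \<cdot>\<^sub>v u_vec + b \<cdot>\<^sub>v w_vec | a b. True}"

lemma dim_uw [simp]: "dim_vec u_vec = 4" "dim_vec w_vec = 4"
  by (simp_all add: u_vec_def w_vec_def)

lemma uw_carrier: "u_vec \<in> carrier_vec 4" "w_vec \<in> carrier_vec 4"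
  by (rule carrier_vecI, simp)+

lemma u_index: "i < 4 \<Longrightarrow> u_vec $ i = 1"
  by (simp add: u_vec_def)

lemma w_index:
  "w_vec $ 0 = [:0, 1:]" "w_vec $ Suc 0 = [:1, 0, 1:]" "w_vec $ 2 = [:1, 1, 1:]" "w_vec $ 3 = 0"
  by (simp_all add: w_vec_def)

lemma degree_w_diff:
  assumes "i < 4" "j < 4" "i \<noteq> j"
  shows "degree (w_vec $ i - w_vec $ j) > 0"
proof -
  have "\<forall>i<4. \<forall>j<4. i \<noteq> j \<longrightarrow> degree (w_vec $ i - w_vec $ j) > 0"
    unfolding all_less_4 by (simp add: w_index)
  with assms show ?thesis by blast
qed

lemma C4_entries:
  assumes "c \<in> C4"
  obtains a b where "dim_vec c = 4" "\<And>i. i < 4 \<Longrightarrow> c $ i = a + b * w_vec $ i"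
  using assms by (auto simp: C4_def u_index)

lemma C4_entries_not_1_0:
  assumes "c \<in> C4" "i < 4" "j < 4" "i \<noteq> j" "c $ i = 1"
  shows "c $ j \<noteq> 0"
proof
  assume "c $ j = 0"
  obtain a b where c: "\<And>i. i < 4 \<Longrightarrow> c $ i = a + b * w_vec $ i"
    using C4_entries[OF assms(1)] by blast
  have "1 = c $ i - c $ j" using assms \<open>c $ j = 0\<close> by simp
  also have "\<dots> = (w_vec $ i - w_vec $ j) * b"
    using assms by (simp add: c algebra_simps)
  finally have "w_vec $ i - w_vec $ j dvd 1" by (rule dvdI)
  \<comment> \<open>\<open>is_unit_iff_degree\<close> speaks of nonzero polynomials;
    \<open>degree_0\<close> settles the zero polynomial.\<close>
  then have "degree (w_vec $ i - w_vec $ j) = 0"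
    by (metis degree_0 is_unit_iff_degree)
  with degree_w_diff assms show False by fastforce
qed

text \<open>Subtracting the two vanishing entries leaves \<open>b\<close> times a nonzero
  polynomial, and \<open>bit poly\<close> is a domain. The values are abstracted to a function
  \<open>c\<close> so that the lemma serves both the weight bound and linear independence.\<close>

lemma C4_two_zeros:
  assumes c: "\<And>i. i < 4 \<Longrightarrow> a + b * w_vec $ i = c i"
    and "i < 4" "j < 4" "i \<noteq> j" "c i = 0" "c j = 0"
  shows "a = 0 \<and> b = 0"
proof -
  have "b * (w_vec $ i - w_vec $ j) = (a + b * w_vec $ i) - (a + b * w_vec $ j)"
    by (simp add: algebra_simps)
  also have "\<dots> = 0" using assms by simp
  finally have "b * (w_vec $ i - w_vec $ j) = 0" .
  moreover have "w_vec $ i - w_vec $ j \<noteq> 0" using degree_w_diff assms by fastforce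
  ultimately have "b = 0" by (metis mult_eq_0_iff)
  with c[of i] assms show ?thesis by simp
qed

lemma wt_C4:
  assumes "c \<in> C4" "c \<noteq> 0\<^sub>v 4"
  shows "wt c \<ge> 3"
proof -
  obtain a b where d: "dim_vec c = 4" and c: "\<And>i. i < 4 \<Longrightarrow> c $ i = a + b * w_vec $ i"
    using C4_entries[OF assms(1)] by blast
  let ?Z = "{j. j < 4 \<and> c $ j = 0}" and ?S = "{j. j < dim_vec c \<and> c $ j \<noteq> 0}"
  have "i = j" if "i \<in> ?Z" "j \<in> ?Z" for i j
  proof (rule ccontr)
    assume "i \<noteq> j"
    then have "a = 0 \<and> b = 0"
      using C4_two_zeros[of a b "\<lambda>i. c $ i" i j] c that by auto
    then have "c = 0\<^sub>v 4" using c d by (intro eq_vecI) auto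
    with assms show False by simp
  qed
  then have "card ?Z \<le> 1" by (auto simp: card_le_Suc0_iff_eq)
  moreover have "?Z \<union> ?S = {..<4}" by (auto simp: d)
  then have "card ?Z + card ?S = card {..<4::nat}"
    by (subst card_Un_disjoint[symmetric]) (auto simp: d)
  ultimately have "card ?S \<ge> 3" by simp
  with card_support_le_wt[of c] show ?thesis by linarith
qed

lemma u_neq_w: "u_vec \<noteq> w_vec"
  using u_index[of 3] w_index(4) by auto

lemma d_free_C4: "d_free 4 C4 > 2"
proof -
  \<comment> \<open>A nonzero codeword is exhibited so that the infimum is attained by some
    weight.\<close>
  have "u_vec = 1 \<cdot>\<^sub>v u_vec + 0 \<cdot>\<^sub>v w_vec" by (intro eq_vecI) auto
  then have "u_vec \<in> C4" unfolding C4_def by blast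
  moreover have "u_vec \<noteq> 0\<^sub>v 4" using u_index[of 0] by (metis index_zero_vec(1) zero_less_numeral zero_neq_one)
  ultimately have "wt ` (C4 - {0\<^sub>v 4}) \<noteq> {}" by blast
  then have "d_free 4 C4 \<in> wt ` (C4 - {0\<^sub>v 4})" unfolding d_free_def by (rule Inf_nat_def1)
  then show ?thesis using wt_C4 by fastforce
qed

section \<open>The code as a free module of rank 2\<close>

lemma generator_matrix_C4: "generator_matrix 4 2 C4 (mat_of_rows 4 [u_vec, w_vec])"
proof -
  interpret vec_module "TYPE(bit poly)" 4 .
  have "a = 0 \<and> b = 0" if "a \<cdot>\<^sub>v u_vec + b \<cdot>\<^sub>v w_vec = 0\<^sub>v 4" for a b
  proof -
    have "a + b * w_vec $ i = 0" if "i < 4" for i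
      using arg_cong[OF \<open>a \<cdot>\<^sub>v u_vec + b \<cdot>\<^sub>v w_vec = 0\<^sub>v 4\<close>, of "\<lambda>v. v $ i"] that
      by (simp add: u_index)
    from C4_two_zeros[of a b "\<lambda>_. 0" 0 1, OF this] show ?thesis by simp
  qed
  then have "lin_indpt {u_vec, w_vec}"
    by (intro lin_indpt_pair uw_carrier u_neq_w)
  moreover have "rows (mat_of_rows 4 [u_vec, w_vec]) = [u_vec, w_vec]"
    by (rule rows_mat_of_rows) (use uw_carrier in auto)
  moreover have "span {u_vec, w_vec} = C4"
    unfolding C4_def by (intro span_pair uw_carrier u_neq_w)
  ultimately show ?thesis
    using u_neq_w by (auto simp: generator_matrix_def numeral_eq_Suc)
qed

lemma conv_code_C4: "conv_code 4 2 C4"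
proof -
  interpret vec_module "TYPE(bit poly)" 4 .
  have "submodule class_ring (span {u_vec, w_vec}) V"
    by (rule span_is_submodule) (use uw_carrier in auto)
  moreover have "span {u_vec, w_vec} = C4"
    unfolding C4_def by (intro span_pair uw_carrier u_neq_w)
  ultimately show ?thesis
    using generator_matrix_C4 by (auto simp: conv_code_def)
qed

section \<open>Self-duality\<close>

lemma scalar_prod_4:
  assumes "dim_vec g = 4"
  shows "f \<bullet> g = f $ 0 * g $ 0 + f $ Suc 0 * g $ Suc 0 + f $ 2 * g $ 2 + f $ 3 * g $ 3"
  using assms by (simp add: scalar_prod_def numeral_eq_Suc add.assoc)

text \<open>Codewords are orthogonal by bilinearity. Conversely, for \<open>f\<close> in the dual,
  orthogonality to \<open>u_vec\<close> gives
  \<open>f = f_3 (1, 1, 1, 1) + (g0, g1, g0 + g1, 0)\<close>; orthogonality to \<open>w_vec\<close>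
  then gives \<open>(z^2 + 1) g0 = z g1\<close>, and coprimality forces
  \<open>(g0, g1) = b (z, z^2 + 1)\<close>.\<close>

lemma self_dual_C4: "self_dual 4 C4"
proof -
  define z :: "bit poly" where "z = [:0, 1:]"
  have w: "w_vec $ 0 = z" "w_vec $ Suc 0 = z^2 + 1" "w_vec $ 2 = z^2 + z + 1" "w_vec $ 3 = 0"
    by (simp_all add: w_index z_def power2_eq_square one_pCons)
  have "c \<in> dual_code 4 C4" if "c \<in> C4" for c
  proof -
    obtain a b where c: "dim_vec c = 4" "\<And>i. i < 4 \<Longrightarrow> c $ i = a + b * w_vec $ i"
      using C4_entries[OF \<open>c \<in> C4\<close>] by blast
    have "c \<bullet> d = 0" if "d \<in> C4" for d
    proof -
      obtain a' b' where d: "dim_vec d = 4" "\<And>i. i < 4 \<Longrightarrow> d $ i = a' + b' * w_vec $ i"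
        using C4_entries[OF \<open>d \<in> C4\<close>] by blast
      have "c \<bullet> d = a * a' * (u_vec \<bullet> u_vec) + (a * b' + b * a') * (u_vec \<bullet> w_vec)
          + b * b' * (w_vec \<bullet> w_vec)"
        by (simp add: scalar_prod_4 c d u_index algebra_simps)
      moreover have "u_vec \<bullet> u_vec = 0" "u_vec \<bullet> w_vec = 0" "w_vec \<bullet> w_vec = 0"
        by (simp_all add: scalar_prod_4 u_index w_index one_pCons)
      ultimately show ?thesis by simp
    qed
    then show ?thesis using c(1) by (auto simp: dual_code_def intro: carrier_vecI)
  qed
  moreover have "f \<in> C4" if "f \<in> dual_code 4 C4" for f
  proof -
    have f: "f \<in> carrier_vec 4" and orth: "\<And>c. c \<in> C4 \<Longrightarrow> f \<bullet> c = 0"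
      using that by (auto simp: dual_code_def)
    have "u_vec = 1 \<cdot>\<^sub>v u_vec + 0 \<cdot>\<^sub>v w_vec" "w_vec = 0 \<cdot>\<^sub>v u_vec + 1 \<cdot>\<^sub>v w_vec"
      by (auto intro!: eq_vecI)
    then have "u_vec \<in> C4" "w_vec \<in> C4" unfolding C4_def by blast+
    from this[THEN orth] have
      fu: "f $ 0 + f $ Suc 0 + f $ 2 + f $ 3 = 0" and
      fw: "f $ 0 * z + f $ Suc 0 * (z^2 + 1) + f $ 2 * (z^2 + z + 1) = 0"
      by (simp_all add: scalar_prod_4 u_index w)
    \<comment> \<open>The last entry of \<open>w_vec\<close> is zero, so the coefficient of
      \<open>u_vec\<close> can only be \<open>f $ 3\<close>; it is subtracted first.\<close>
    define g0 where "g0 = f $ 0 - f $ 3"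
    define g1 where "g1 = f $ Suc 0 - f $ 3"
    have f0: "f $ 0 = f $ 3 + g0" and f1: "f $ Suc 0 = f $ 3 + g1"
      by (simp_all add: g0_def g1_def)
    \<comment> \<open>A commutative ring identity: the second bracket vanishes by \<open>fu\<close>,
      the even term by characteristic 2. The derivation of \<open>key\<close> follows the same
      pattern with \<open>fw\<close>.\<close>
    have "f $ 2 = f $ 3 + (g0 + g1) + (f $ 0 + f $ Suc 0 + f $ 2 + f $ 3)
        + 2 * (- 2 * f $ 3 - g0 - g1)"
      unfolding f0 f1 by (simp add: algebra_simps)
    then have "f $ 2 = f $ 3 + (g0 + g1) + 2 * (- 2 * f $ 3 - g0 - g1)"
      by (simp only: fu add_0_right)
    then have f2: "f $ 2 = f $ 3 + (g0 + g1)" by (rule bit_poly_eqI)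
    have "(z^2 + 1) * g0 = z * g1
        + (f $ 0 * z + f $ Suc 0 * (z^2 + 1) + f $ 2 * (z^2 + z + 1))
        + 2 * (- g0 * z - g1 * (z^2 + z + 1) - f $ 3 * (z^2 + z + 1))"
      unfolding f0 f1 f2 by (simp add: algebra_simps)
    then have "(z^2 + 1) * g0 = z * g1
        + 2 * (- g0 * z - g1 * (z^2 + z + 1) - f $ 3 * (z^2 + z + 1))"
      by (simp only: fw add_0_right)
    then have key: "(z^2 + 1) * g0 = z * g1" by (rule bit_poly_eqI)
    text \<open>The factor \<open>b\<close> comes from the Bezout identity \<open>(z^2 + 1) - z * z = 1\<close>.\<close>
    define b where "b = g1 - z * g0"
    have "b * z = g0 + (z * g1 - (z^2 + 1) * g0)"
      by (simp add: b_def algebra_simps power2_eq_square)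
    then have g0: "g0 = b * z" by (simp only: key diff_self add_0_right)
    have "b * (z^2 + 1) = g1 + z * (z * g1 - (z^2 + 1) * g0)"
      by (simp add: b_def algebra_simps power2_eq_square)
    then have g1: "g1 = b * (z^2 + 1)" by (simp only: key diff_self add_0_right mult_zero_right)
    have g01: "g0 + g1 = b * (z^2 + z + 1)"
      by (subst g0, subst g1) (simp add: distrib_left add.commute add.left_commute)
    define h where "h = f $ 3"
    have "\<forall>i<4. f $ i = h + b * w_vec $ i"
      unfolding all_less_4 h_def by (simp add: w f0 f1 f2 g01 g0[symmetric] g1[symmetric])
    then have "f = h \<cdot>\<^sub>v u_vec + b \<cdot>\<^sub>v w_vec"
      using f by (intro eq_vecI) (auto simp: u_index)
    then show ?thesis unfolding C4_def by blast
  qed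
  ultimately show ?thesis unfolding self_dual_def by blast
qed

theorem lemma11:
  shows "\<exists>n k (C :: bit poly vec set).
           k \<ge> 1 \<and> conv_code n k C \<and> self_dual n C \<and> d_free n C > 2 \<and>
           \<not> (\<exists>\<pi> M. \<pi> permutes {..<n} \<and> building_up_matrix M \<and>
                generator_matrix n k (permute_code n \<pi> C) M)"
proof -
  have False if \<pi>: "\<pi> permutes {..<4}" and M: "building_up_matrix M"
    and G: "generator_matrix 4 2 (permute_code 4 \<pi> C4) M" for \<pi> M
  proof -
    note M = building_up_matrix_entries[OF M]
    \<comment> \<open>The first row of \<open>M\<close> starts with 1, 0. Pulled back along the
      injective \<open>\<pi>\<close>, it is a codeword with these values at two distinct
      positions.\<close>
    obtain c where c: "c \<in> C4" and row: "row M 0 = vec 4 (\<lambda>i. c $ \<pi> i)"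
      using row_in_code[OF G M(1)] by (auto simp: permute_code_def)
    have "\<pi> 0 < 4" "\<pi> 1 < 4" using permutes_in_image[OF \<pi>] by auto
    moreover have "\<pi> 0 \<noteq> \<pi> 1" using permutes_inj[OF \<pi>] by (auto dest: injD)
    moreover have "c $ \<pi> 0 = 1" "c $ \<pi> 1 = 0" using M(2,3) row by auto
    ultimately show False using C4_entries_not_1_0[OF c] by blast
  qed
  then show ?thesis
    using conv_code_C4 self_dual_C4 d_free_C4
    by (intro exI[of _ "4::nat"] exI[of _ "2::nat"] exI[of _ C4]) auto
qed

end
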